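(* Let $R$ be an integral domain of characteristic $0$, $k\ge 1$, and $T=H_R^k[[\mathbf{x}]]$. The set $\rho_t\mathfrak{A}_T(\mathbf{x})=\{\rho_t\mathfrak{A}_\phi(\mathbf{x}):\phi\in T\}$ with the sum $\boxplus$ and the product $\odot$ is a commutative ring, with additive unit $\rho_t\mathfrak{A}_{\mathbf 0}(\mathbf{x})=\mathbf{x}$ and multiplicative unit $\rho_t\mathfrak{A}_{\mathbf 1}(\mathbf{x})=\mathbf{x}+\mathbf{1}t$.
   Context: $\mathbb{N}=\{0,1,2,\dots\}$. $H_R[[\mathbf{x}]]$ is the ring of formal series $\sum_{\mathbf n\in\mathbb{N}^k}a_{\mathbf n}\frac{x_1^{n_1}\cdots x_k^{n_k}}{n_1!\cdots n_k!}$ with $a_{\mathbf n}\in R$, with the usual addition and multiplication of power series (one may view it inside $\mathrm{Frac}(R)[[x_1,\dots,x_k]]$), and $\partial_l=\partial/\partial x_l$. $H_R^k[[\mathbf{x}]]$ is the direct product of $k$ copies of $H_R[[\mathbf{x}]]$, with componentwise sum and product $\cdot$; $\mathbf 0=(0,\dots,0)$, $\mathbf 1=(1,\dots,1)$, and $\mathbf{x}$ as an element of it means $(x_1,\dots,x_k)$. For $\phi=(\phi_1,\dots,\phi_k)\in T$ and $F=(f_1,\dots,f_k)\in T$, $\mathfrak{D}_\phi(F)=\frac{\partial F}{\partial\mathbf{x}}\phi^\top$ is the element of $T$ with $i$-th component $\sum_{l=1}^k\partial_l(f_i)\phi_l$; $\mathfrak{D}_\phi^0(F)=F$, $\mathfrak{D}_\phi^{n+1}(F)=\mathfrak{D}_\phi(\mathfrak{D}_\phi^n(F))$.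 Put $\mathfrak{A}_\phi(F)=(\mathfrak{D}_\phi^n(F))_{n\in\mathbb{N}}$ and $\rho_t\mathfrak{A}_\phi(F)=F+\sum_{n\ge1}\mathfrak{D}_\phi^n(F)\frac{t^n}{n!}$, a formal series in $t$ with coefficients in $T$; more generally $\rho_t((c_n)_{n\in\mathbb N})=\sum_{n\ge 0}c_n\frac{t^n}{n!}$. On sequences: $\mathfrak{A}_\phi(\mathbf{x})\boxplus\mathfrak{A}_\psi(\mathbf{x})=(B_n)_{n\in\mathbb{N}}$ with $B_0=\mathbf{x}$, $B_1=\mathfrak{D}_\phi(\mathbf{x})+\mathfrak{D}_\psi(\mathbf{x})$, $B_n=\mathfrak{D}^n_\phi(\mathbf{x})+\mathfrak{D}^n_\psi(\mathbf{x})+H_n(\phi,\psi)$ for $n\ge2$, where $H_1(\phi,\psi)=0$ and $H_{n+1}(\phi,\psi)=\mathfrak{D}_\phi(\mathfrak{D}_\psi^n(\mathbf{x}))+\mathfrak{D}_\psi(\mathfrak{D}_\phi^n(\mathbf{x}))+\mathfrak{D}_{\phi+\psi}(H_n(\phi,\psi))$ for $n\ge 1$. Also $\mathfrak{A}_\phi(\mathbf{x})\odot\mathfrak{A}_\psi(\mathbf{x})=(C_n)_{n\in\mathbb{N}}$ with $C_0=\mathbf{x}$ and $C_n=\sum_{l=0}^{n-1}\binom{n-1}{l}\mathfrak{D}_{\phi\cdot\psi}^{l}(\mathfrak{D}_\phi(\mathbf{x}))\cdot\mathfrak{D}_{\phi\cdot\psi}^{n-1-l}(\mathfrak{D}_\psi(\mathbf{x}))$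 for $n\ge1$. On series: $\rho_t\mathfrak{A}_\phi(\mathbf{x})\boxplus\rho_t\mathfrak{A}_\psi(\mathbf{x})=\rho_t[\mathfrak{A}_\phi(\mathbf{x})\boxplus\mathfrak{A}_\psi(\mathbf{x})]$ and $\rho_t\mathfrak{A}_\phi(\mathbf{x})\odot\rho_t\mathfrak{A}_\psi(\mathbf{x})=\rho_t[\mathfrak{A}_\phi(\mathbf{x})\odot\mathfrak{A}_\psi(\mathbf{x})]$. *)

theory Defs
  imports
    "HOL-Analysis.Finite_Cartesian_Product"
    "HOL-Computational_Algebra.Fraction_Field"
    "HOL-Algebra.Ring"
begin

(* Formal series  sum_n a_n x^n / n!  over multi-indices n :: 'k => nat, with x^n / n! the product
   of the x_i^(n i) / (n i)!.  A series is stored as its family (a_n) of coefficients in 'a, so that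
   no division in 'a is needed. *)

typedef ('a, 'k) hseries = "UNIV :: (('k \<Rightarrow> nat) \<Rightarrow> 'a) set"
  morphisms hcoeff Abs_hseries
  by simp

lemma hseries_eqI: "(\<And>n. hcoeff f n = hcoeff g n) \<Longrightarrow> f = g"
  by (simp add: hcoeff_inject[symmetric] fun_eq_iff)

lemma hcoeff_Abs [simp]: "hcoeff (Abs_hseries a) = a"
  by (simp add: Abs_hseries_inverse)

definition mchoose :: "('k::finite \<Rightarrow> nat) \<Rightarrow> ('k \<Rightarrow> nat) \<Rightarrow> nat" where
  "mchoose n m = (\<Prod>i\<in>UNIV. n i choose m i)"

definition mfact :: "('k::finite \<Rightarrow> nat) \<Rightarrow> nat" where
  "mfact n = (\<Prod>i\<in>UNIV. fact (n i))"

lemma finite_multi_atMost [simp]: "finite {..n :: 'k::finite \<Rightarrow> nat}"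
proof -
  have "{..n} = (\<Pi>\<^sub>E i\<in>UNIV. {..n i})"
    by (auto simp: le_fun_def PiE_def extensional_def Pi_iff)
  then show ?thesis
    by (simp add: finite_PiE)
qed

lemma multi_le_diff_cancel: "m \<le> n \<Longrightarrow> n - (n - m) = m" for m n :: "'k \<Rightarrow> nat"
  by (auto simp: le_fun_def fun_eq_iff)

lemma multi_diff_le: "n - m \<le> n" for m n :: "'k \<Rightarrow> nat"
  by (auto simp: le_fun_def)

lemma mchoose_symmetric: "m \<le> n \<Longrightarrow> mchoose n (n - m) = mchoose n m"
  unfolding mchoose_def by (intro prod.cong) (auto simp: le_fun_def binomial_symmetric[symmetric])

lemma mchoose_mult:
  assumes "l \<le> m" "m \<le> n"
  shows "mchoose n m * mchoose m l = mchoose n l * mchoose (n - l) (m - l)"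
  unfolding mchoose_def prod.distrib[symmetric]
  using assms by (intro prod.cong) (auto simp: le_fun_def choose_mult)

lemma mchoose_zero [simp]: "mchoose n (\<lambda>_. 0) = 1"
  by (simp add: mchoose_def)

(* Product of power series in the basis x^n / n!:
   x^m / m! * x^p / p! = (m + p choose m) * x^(m + p) / (m + p)!.
   See hseries_to_mps_mult below. *)

instantiation hseries :: (comm_ring_1, finite) comm_ring_1
begin

definition zero_hseries :: "('a, 'b) hseries" where
  "0 = Abs_hseries (\<lambda>n. 0)"

definition one_hseries :: "('a, 'b) hseries" where
  "1 = Abs_hseries (\<lambda>n. if n = (\<lambda>_. 0) then 1 else 0)"

definition plus_hseries :: "('a, 'b) hseries \<Rightarrow> ('a, 'b) hseries \<Rightarrow> ('a, 'b) hseries" where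
  "f + g = Abs_hseries (\<lambda>n. hcoeff f n + hcoeff g n)"

definition uminus_hseries :: "('a, 'b) hseries \<Rightarrow> ('a, 'b) hseries" where
  "- f = Abs_hseries (\<lambda>n. - hcoeff f n)"

definition minus_hseries :: "('a, 'b) hseries \<Rightarrow> ('a, 'b) hseries \<Rightarrow> ('a, 'b) hseries" where
  "f - g = Abs_hseries (\<lambda>n. hcoeff f n - hcoeff g n)"

definition times_hseries :: "('a, 'b) hseries \<Rightarrow> ('a, 'b) hseries \<Rightarrow> ('a, 'b) hseries" where
  "f * g = Abs_hseries (\<lambda>n. \<Sum>m\<in>{..n}. of_nat (mchoose n m) * hcoeff f m * hcoeff g (n - m))"

lemma hcoeff_mult:
  "hcoeff (f * g) n = (\<Sum>m\<in>{..n}. of_nat (mchoose n m) * hcoeff f m * hcoeff g (n - m))"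
  for f g :: "('a, 'b) hseries"
  by (simp add: times_hseries_def)

instance
proof
  fix f g h :: "('a, 'b) hseries"
  show "f + g + h = f + (g + h)" "f + g = g + f" "0 + f = f" "- f + f = 0" "f - g = f + - g"
    by (auto intro!: hseries_eqI simp: plus_hseries_def zero_hseries_def uminus_hseries_def
        minus_hseries_def add_ac)
  show "(f + g) * h = f * h + g * h"
    by (auto intro!: hseries_eqI simp: plus_hseries_def times_hseries_def algebra_simps sum.distrib)
  show "(0 :: ('a, 'b) hseries) \<noteq> 1"
  proof
    assume "(0 :: ('a, 'b) hseries) = 1"
    then have "hcoeff (0 :: ('a, 'b) hseries) (\<lambda>_. 0) = hcoeff 1 (\<lambda>_. 0)"
      by (rule arg_cong)
    then show False
      by (simp add: zero_hseries_def one_hseries_def)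
  qed
  show "f * g = g * f"
  proof (rule hseries_eqI)
    fix n
    show "hcoeff (f * g) n = hcoeff (g * f) n"
      unfolding hcoeff_mult
      by (rule sum.reindex_bij_witness[of _ "\<lambda>m. n - m" "\<lambda>m. n - m"])
        (auto simp: multi_le_diff_cancel multi_diff_le mchoose_symmetric mult_ac)
  qed
  show "1 * f = f"
  proof (rule hseries_eqI)
    fix n
    have "hcoeff (1 * f) n = (\<Sum>m\<in>{..n}. if m = (\<lambda>_. 0) then hcoeff f n else 0)"
      unfolding hcoeff_mult one_hseries_def
      by (intro sum.cong) (auto simp: fun_diff_def)
    also have "\<dots> = hcoeff f n"
      by (simp add: le_fun_def)
    finally show "hcoeff (1 * f) n = hcoeff f n" .
  qed
  show "f * g * h = f * (g * h)"
  proof (rule hseries_eqI)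
    fix n
    have "hcoeff (f * g * h) n =
      (\<Sum>(m, l)\<in>Sigma {..n} (\<lambda>m. {..m}). of_nat (mchoose n m * mchoose m l) * hcoeff f l *
         hcoeff g (m - l) * hcoeff h (n - m))"
      by (simp add: hcoeff_mult sum_distrib_left sum_distrib_right sum.Sigma[symmetric] mult_ac)
    also have "\<dots> =
      (\<Sum>(l, p)\<in>Sigma {..n} (\<lambda>l. {..n - l}). of_nat (mchoose n l * mchoose (n - l) p) * hcoeff f l *
         hcoeff g p * hcoeff h (n - l - p))"
    proof (rule sum.reindex_bij_witness[of _ "\<lambda>(l, p). (\<lambda>i. l i + p i, l)" "\<lambda>(m, l). (l, m - l)"],
        goal_cases)
      case (1 a)
      then show ?case
        by (auto simp: le_fun_def fun_eq_iff)
    next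
      case (2 a)
      obtain m l where a: "a = (m, l)" by (cases a)
      from 2 a have le: "l \<le> m" "m \<le> n" by auto
      then have "l \<le> n" by (rule order.trans)
      moreover have "m - l \<le> n - l"
        using le by (auto simp: le_fun_def intro: diff_le_mono)
      ultimately show ?case using a by simp
    next
      case (3 b)
      then show ?case
        by (auto simp: fun_eq_iff)
    next
      case (4 b)
      obtain l p where b: "b = (l, p)" by (cases b)
      from 4 b have "\<And>i. l i \<le> n i" "\<And>i. p i \<le> n i - l i"
        by (auto simp: le_fun_def)
      then have "\<And>i. l i + p i \<le> n i"
        by (metis Nat.le_diff_conv2 add.commute)
      then show ?case using b by (auto simp: le_fun_def)
    next
      case (5 a)
      obtain m l where a: "a = (m, l)" by (cases a)
      from 5 a have le: "l \<le> m" "m \<le> n" by auto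
      then have "n - l - (m - l) = n - m"
        by (auto simp: le_fun_def fun_eq_iff)
      with a le show ?case by (simp add: mchoose_mult del: of_nat_mult)
    qed
    also have "\<dots> = hcoeff (f * (g * h)) n"
      by (simp add: hcoeff_mult sum_distrib_left sum_distrib_right sum.Sigma[symmetric] mult_ac)
    finally show "hcoeff (f * g * h) n = hcoeff (f * (g * h)) n" .
  qed
qed

end

definition hconst :: "'a \<Rightarrow> ('a::zero, 'k) hseries" where
  "hconst c = Abs_hseries (\<lambda>n. if n = (\<lambda>_. 0) then c else 0)"

definition hvar :: "'k \<Rightarrow> ('a::zero_neq_one, 'k) hseries" where
  "hvar l = Abs_hseries (\<lambda>n. if n = (\<lambda>_. 0)(l := 1) then 1 else 0)"

(* d/dx_l maps x^n / n! to x^(n - e_l) / (n - e_l)!, that is, it shifts coefficients. *)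
definition hderiv :: "'k \<Rightarrow> ('a, 'k) hseries \<Rightarrow> ('a, 'k) hseries" where
  "hderiv l f = Abs_hseries (\<lambda>n. hcoeff f (n(l := Suc (n l))))"

(* The ordinary power series over the fraction field that a series denotes; the lemmas below
   identify the operations on hseries with the usual product and partial derivatives. *)
definition hseries_to_mps :: "('a::{idom, ring_char_0}, 'k::finite) hseries \<Rightarrow> ('k \<Rightarrow> nat) \<Rightarrow> 'a fract" where
  "hseries_to_mps f n = Fract (hcoeff f n) (of_nat (mfact n))"

lemma mfact_nonzero [simp]: "mfact n \<noteq> 0"
  by (simp add: mfact_def)

lemma mfact_mchoose: "m \<le> n \<Longrightarrow> mfact n = mchoose n m * mfact m * mfact (n - m)"
  unfolding mfact_def mchoose_def prod.distrib[symmetric]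
proof (rule prod.cong)
  fix i assume "m \<le> n"
  then have "fact (m i) * fact (n i - m i) * (n i choose m i) = (fact (n i) :: nat)"
    by (simp add: le_fun_def binomial_fact_lemma)
  then show "fact (n i) = (n i choose m i) * fact (m i) * fact ((n - m) i)"
    by (simp add: mult_ac)
qed simp

lemma Fract_sum: "d \<noteq> 0 \<Longrightarrow> Fract (sum f S) d = (\<Sum>x\<in>S. Fract (f x) d)"
proof (induction S rule: infinite_finite_induct)
  case (insert x S)
  then show ?case
    by (simp add: insert.IH[symmetric] eq_fract algebra_simps)
qed (auto simp: Zero_fract_def eq_fract)

lemma inj_hseries_to_mps: "inj hseries_to_mps"
proof (rule injI, rule hseries_eqI)
  fix f g :: "('a, 'b) hseries" and n
  assume "hseries_to_mps f = hseries_to_mps g"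
  then have "Fract (hcoeff f n) (of_nat (mfact n)) = Fract (hcoeff g n) (of_nat (mfact n))"
    by (simp add: fun_eq_iff hseries_to_mps_def)
  then show "hcoeff f n = hcoeff g n"
    by (simp add: eq_fract)
qed

lemma hseries_to_mps_add:
  "hseries_to_mps (f + g) n = hseries_to_mps f n + hseries_to_mps g n"
  by (simp add: hseries_to_mps_def plus_hseries_def eq_fract algebra_simps)

lemma hseries_to_mps_mult:
  "hseries_to_mps (f * g) n = (\<Sum>m\<in>{..n}. hseries_to_mps f m * hseries_to_mps g (n - m))"
proof -
  have "hseries_to_mps (f * g) n =
      (\<Sum>m\<in>{..n}. Fract (of_nat (mchoose n m) * hcoeff f m * hcoeff g (n - m)) (of_nat (mfact n)))"
    by (simp add: hseries_to_mps_def hcoeff_mult Fract_sum)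
  also have "\<dots> = (\<Sum>m\<in>{..n}. hseries_to_mps f m * hseries_to_mps g (n - m))"
  proof (rule sum.cong)
    fix m assume "m \<in> {..n}"
    then have "mfact n = mchoose n m * mfact m * mfact (n - m)"
      by (simp add: mfact_mchoose)
    moreover from this have "mchoose n m \<noteq> 0"
      by (metis mfact_nonzero mult_zero_left)
    ultimately show "Fract (of_nat (mchoose n m) * hcoeff f m * hcoeff g (n - m)) (of_nat (mfact n)) =
        hseries_to_mps f m * hseries_to_mps g (n - m)"
      by (simp add: hseries_to_mps_def eq_fract mult_ac)
  qed simp
  finally show ?thesis .
qed

lemma hseries_to_mps_deriv:
  "hseries_to_mps (hderiv l f) n = of_nat (Suc (n l)) * hseries_to_mps f (n(l := Suc (n l)))"
proof -
  have "mfact (n(l := Suc (n l))) = Suc (n l) * mfact n"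
    by (simp add: mfact_def prod.remove[of UNIV l] algebra_simps)
  then show ?thesis
    by (simp add: hseries_to_mps_def hderiv_def of_nat_fract eq_fract mult_ac
        del: of_nat_Suc mult_Suc mult_Suc_right)
qed

lemma hseries_to_mps_hvar:
  "hseries_to_mps (hvar l) n = (if n = (\<lambda>_. 0)(l := 1) then 1 else 0)"
proof -
  have "mfact ((\<lambda>_. 0)(l := 1)) = 1"
    unfolding mfact_def by (intro prod.neutral) auto
  then show ?thesis
    by (auto simp: hseries_to_mps_def hvar_def Zero_fract_def One_fract_def eq_fract)
qed

(* H_R^k[[x]] is the type ('a, 'k) hseries ^ 'k with k = CARD('k); all arithmetic on ^, including
   * and 1, is componentwise. *)
type_synonym ('a, 'k) hvec = "('a, 'k) hseries ^ 'k"

definition xvec :: "('a::comm_ring_1, 'k::finite) hvec" where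
  "xvec = (\<chi> i. hvar i)"

definition DD :: "('a::comm_ring_1, 'k::finite) hvec \<Rightarrow> ('a, 'k) hvec \<Rightarrow> ('a, 'k) hvec" where
  "DD \<phi> F = (\<chi> i. \<Sum>l\<in>UNIV. hderiv l (F $ i) * \<phi> $ l)"

definition AA :: "('a::comm_ring_1, 'k::finite) hvec \<Rightarrow> ('a, 'k) hvec \<Rightarrow> nat \<Rightarrow> ('a, 'k) hvec" where
  "AA \<phi> F n = (DD \<phi> ^^ n) F"

(* H_0 does not occur in the theory; its value here is irrelevant. *)
fun HH :: "('a::comm_ring_1, 'k::finite) hvec \<Rightarrow> ('a, 'k) hvec \<Rightarrow> nat \<Rightarrow> ('a, 'k) hvec" where
  "HH \<phi> \<psi> 0 = 0"
| "HH \<phi> \<psi> (Suc 0) = 0"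
| "HH \<phi> \<psi> (Suc (Suc n)) =
     DD \<phi> ((DD \<psi> ^^ Suc n) xvec) + DD \<psi> ((DD \<phi> ^^ Suc n) xvec) + DD (\<phi> + \<psi>) (HH \<phi> \<psi> (Suc n))"

definition sum_seq :: "('a::comm_ring_1, 'k::finite) hvec \<Rightarrow> ('a, 'k) hvec \<Rightarrow> nat \<Rightarrow> ('a, 'k) hvec" where
  "sum_seq \<phi> \<psi> n =
    (if n = 0 then xvec
     else if n = 1 then DD \<phi> xvec + DD \<psi> xvec
     else (DD \<phi> ^^ n) xvec + (DD \<psi> ^^ n) xvec + HH \<phi> \<psi> n)"

definition prod_seq :: "('a::comm_ring_1, 'k::finite) hvec \<Rightarrow> ('a, 'k) hvec \<Rightarrow> nat \<Rightarrow> ('a, 'k) hvec" where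
  "prod_seq \<phi> \<psi> n =
    (if n = 0 then xvec
     else \<Sum>l = 0..n - 1. of_nat ((n - 1) choose l) *
       ((DD (\<phi> * \<psi>) ^^ l) (DD \<phi> xvec) * (DD (\<phi> * \<psi>) ^^ (n - 1 - l)) (DD \<psi> xvec)))"

(* The operations on sequences and on series are given by formulas in \<phi> and \<psi>, which are recovered
   from the arguments with the_inv; this is legitimate by inj_AA_xvec and inj_rho below. *)

definition seq_boxplus ::
  "(nat \<Rightarrow> ('a::comm_ring_1, 'k::finite) hvec) \<Rightarrow> (nat \<Rightarrow> ('a, 'k) hvec) \<Rightarrow> nat \<Rightarrow> ('a, 'k) hvec" where
  "seq_boxplus a b = sum_seq (the_inv (\<lambda>\<phi>. AA \<phi> xvec) a) (the_inv (\<lambda>\<phi>. AA \<phi> xvec) b)"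

definition seq_odot ::
  "(nat \<Rightarrow> ('a::comm_ring_1, 'k::finite) hvec) \<Rightarrow> (nat \<Rightarrow> ('a, 'k) hvec) \<Rightarrow> nat \<Rightarrow> ('a, 'k) hvec" where
  "seq_odot a b = prod_seq (the_inv (\<lambda>\<phi>. AA \<phi> xvec) a) (the_inv (\<lambda>\<phi>. AA \<phi> xvec) b)"

(* Series  sum_n c_n t^n / n!  in the single variable t = hvar (). *)
definition rho :: "(nat \<Rightarrow> 'c) \<Rightarrow> ('c, unit) hseries" where
  "rho c = Abs_hseries (\<lambda>n. c (n ()))"

definition boxplus ::
  "(('a::comm_ring_1, 'k::finite) hvec, unit) hseries \<Rightarrow> (('a, 'k) hvec, unit) hseries \<Rightarrow>
    (('a, 'k) hvec, unit) hseries" where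
  "boxplus f g = rho (seq_boxplus (the_inv rho f) (the_inv rho g))"

definition odot ::
  "(('a::comm_ring_1, 'k::finite) hvec, unit) hseries \<Rightarrow> (('a, 'k) hvec, unit) hseries \<Rightarrow>
    (('a, 'k) hvec, unit) hseries" where
  "odot f g = rho (seq_odot (the_inv rho f) (the_inv rho g))"

lemma hderiv_hvar: "hderiv l (hvar i) = (if l = i then 1 else (0 :: ('a::comm_ring_1, 'k::finite) hseries))"
proof (rule hseries_eqI)
  fix n :: "'k \<Rightarrow> nat"
  have "n(l := Suc (n l)) = (\<lambda>_. 0)(i := 1) \<longleftrightarrow> l = i \<and> n = (\<lambda>_. 0)"
    by (auto simp: fun_eq_iff split: if_splits)
  then show "hcoeff (hderiv l (hvar i)) n = hcoeff (if l = i then 1 else (0 :: ('a, 'k) hseries)) n"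
    by (auto simp: hderiv_def hvar_def one_hseries_def zero_hseries_def)
qed

lemma DD_xvec: "DD \<phi> xvec = \<phi>"
  by (simp add: DD_def xvec_def hderiv_hvar vec_eq_iff if_distrib[of "\<lambda>x. x * _"] cong: if_cong)

lemma inj_AA_xvec: "inj (\<lambda>\<phi>. AA \<phi> xvec)"
proof (rule injI)
  fix \<phi> \<psi> :: "('a::comm_ring_1, 'k::finite) hvec"
  assume "AA \<phi> xvec = AA \<psi> xvec"
  then have "AA \<phi> xvec 1 = AA \<psi> xvec 1" by simp
  then show "\<phi> = \<psi>" by (simp add: AA_def DD_xvec)
qed

lemma inj_rho: "inj rho"
proof (rule injI)
  fix c d :: "nat \<Rightarrow> 'c"
  assume "rho c = rho d"
  then have eq: "hcoeff (rho c) n = hcoeff (rho d) n" for n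
    by simp
  show "c = d"
  proof
    fix j
    show "c j = d j"
      using eq[of "\<lambda>_. j"] by (simp add: rho_def)
  qed
qed

lemma seq_boxplus_AA: "seq_boxplus (AA \<phi> xvec) (AA \<psi> xvec) = sum_seq \<phi> \<psi>"
  by (simp add: seq_boxplus_def the_inv_f_f[OF inj_AA_xvec])

lemma seq_odot_AA: "seq_odot (AA \<phi> xvec) (AA \<psi> xvec) = prod_seq \<phi> \<psi>"
  by (simp add: seq_odot_def the_inv_f_f[OF inj_AA_xvec])

lemma boxplus_rho:
  "boxplus (rho (AA \<phi> xvec)) (rho (AA \<psi> xvec)) = rho (seq_boxplus (AA \<phi> xvec) (AA \<psi> xvec))"
  by (simp add: boxplus_def the_inv_f_f[OF inj_rho])

lemma odot_rho:
  "odot (rho (AA \<phi> xvec)) (rho (AA \<psi> xvec)) = rho (seq_odot (AA \<phi> xvec) (AA \<psi> xvec))"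
  by (simp add: odot_def the_inv_f_f[OF inj_rho])

end

theory Submission
  imports Defs
begin

text \<open>
  The map \<open>\<phi> \<mapsto> rho (AA \<phi> xvec)\<close> from \<open>T\<close> to series in \<open>t\<close> is injective, because \<open>\<phi>\<close> is the
  coefficient of \<open>t\<close>. The claim is that it carries the componentwise sum and product of \<open>T\<close> to
  \<open>boxplus\<close> and \<open>odot\<close>; the commutative ring structure of \<open>T\<close> is then transported to the image.

  Both halves come down to the behaviour of the operators \<^term>\<open>DD \<theta>\<close>. They are additive in
  their argument and in \<open>\<theta>\<close>, and expanding \<open>(DD \<phi> + DD \<psi>)\<^sup>n xvec\<close> one factor at a time leaves,
  besides the two pure powers, exactly the mixed terms that \<^term>\<open>HH \<phi> \<psi> n\<close> collects; this is
  \<open>sum_seq_eq_AA\<close>.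
  They are also derivations for the componentwise product, since partial derivatives are
  (\<open>hderiv_mult\<close>), and \<^term>\<open>DD \<theta> xvec = \<theta>\<close>. Hence, for positive \<open>n\<close>,
  \<open>DD (\<phi> * \<psi>)\<^sup>n xvec = DD (\<phi> * \<psi>)\<^sup>n\<^sup>-\<^sup>1 (\<phi> * \<psi>)\<close>, and the general Leibniz rule expands the right
  side into the sum that defines \<^term>\<open>prod_seq \<phi> \<psi> n\<close>; this is \<open>prod_seq_eq_AA\<close>.

  The units are read off from coefficients: every derivation kills \<open>1\<close>, so the powers of
  \<^term>\<open>DD 1\<close> applied to \<^term>\<open>xvec\<close> are \<open>xvec, 1, 0, 0, \<dots>\<close>.
\<close>

section \<open>Derivations and the Leibniz rule\<close>

text \<open>
  Pascal's rule in one coordinate. The case distinction keeps the truncated difference \<open>m l - 1\<close>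
  from contributing a spurious term at \<open>m l = 0\<close>.
\<close>

lemma mchoose_Suc_upd:
  "mchoose (n(l := Suc (n l))) m =
     mchoose n m + (if m l = 0 then 0 else mchoose n (m(l := m l - 1)))"
proof -
  have split: "mchoose a b = (a l choose b l) * (\<Prod>i\<in>UNIV - {l}. a i choose b i)" for a b
    unfolding mchoose_def by (rule prod.remove) auto
  show ?thesis
    by (cases "m l") (simp_all add: split algebra_simps)
qed

lemma hcoeff_add: "hcoeff (f + g) n = hcoeff f n + hcoeff g n"
  for f g :: "('a::comm_ring_1, 'k::finite) hseries"
  by (simp add: plus_hseries_def)

lemma hcoeff_hderiv: "hcoeff (hderiv l f) n = hcoeff f (n(l := Suc (n l)))"
  by (simp add: hderiv_def)

lemma hderiv_add: "hderiv l (f + g) = hderiv l f + hderiv l g"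
  for f g :: "('a::comm_ring_1, 'k::finite) hseries"
  by (rule hseries_eqI) (simp add: hcoeff_hderiv hcoeff_add)

text \<open>
  In the basis \<open>x\<^sup>n / n!\<close> differentiation only shifts coefficients, so no factor \<open>n l\<close> appears and
  the two summands of the product rule come from the two summands of Pascal's rule.
\<close>

lemma hderiv_mult: "hderiv l (f * g) = hderiv l f * g + f * hderiv l g"
  for f g :: "('a::comm_ring_1, 'k::finite) hseries"
proof (rule hseries_eqI)
  fix n :: "'k \<Rightarrow> nat"
  define up :: "('k \<Rightarrow> nat) \<Rightarrow> 'k \<Rightarrow> nat" where "up m = m(l := Suc (m l))" for m
  define A where "A m = hcoeff f m * hcoeff g (up n - m)" for m
  have "hcoeff (hderiv l (f * g)) n = (\<Sum>m\<in>{..up n}. of_nat (mchoose (up n) m) * A m)"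
    by (simp add: hcoeff_hderiv hcoeff_mult A_def up_def mult.assoc)
  also have "\<dots> = (\<Sum>m\<in>{..up n}. of_nat (mchoose n m) * A m) +
      (\<Sum>m\<in>{..up n}. if m l = 0 then 0 else of_nat (mchoose n (m(l := m l - 1))) * A m)"
    unfolding up_def mchoose_Suc_upd sum.distrib[symmetric]
    by (intro sum.cong) (auto simp: algebra_simps)
  \<comment> \<open>The first sum leaves \<open>f\<close> alone and differentiates \<open>g\<close>; the second does the converse.\<close>
  also have "(\<Sum>m\<in>{..up n}. of_nat (mchoose n m) * A m) = hcoeff (f * hderiv l g) n"
  proof -
    have le: "m \<le> up n" if "m \<le> n" for m
      using that by (auto simp: le_fun_def up_def intro: le_SucI)
    \<comment> \<open>A multi-index below \<open>up n\<close> but not below \<open>n\<close> exceeds \<open>n\<close> in position \<open>l\<close>.\<close>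
    have zero: "mchoose n m = 0" if "\<not> m \<le> n" for m
    proof -
      from that obtain i where "n i < m i"
        by (auto simp: le_fun_def not_le)
      then show ?thesis
        unfolding mchoose_def by (intro prod_zero) (auto intro!: bexI[of _ i])
    qed
    have diff: "up n - m = up (n - m)" if "m \<le> n" for m
      using that by (auto simp: fun_eq_iff up_def le_fun_def Suc_diff_le)
    have "(\<Sum>m\<in>{..up n}. of_nat (mchoose n m) * A m) = (\<Sum>m\<in>{..n}. of_nat (mchoose n m) * A m)"
      by (rule sum.mono_neutral_right) (auto simp: le zero)
    also have "\<dots> = hcoeff (f * hderiv l g) n"
      unfolding hcoeff_mult
      by (rule sum.cong) (auto simp: A_def hcoeff_hderiv mult.assoc diff, simp add: up_def)
    finally show ?thesis .
  qed
  also have "(\<Sum>m\<in>{..up n}. if m l = 0 then 0 else of_nat (mchoose n (m(l := m l - 1))) * A m) =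
      hcoeff (hderiv l f * g) n"
  proof -
    have "(\<Sum>m\<in>{..up n}. if m l = 0 then 0 else of_nat (mchoose n (m(l := m l - 1))) * A m) =
        (\<Sum>m\<in>{m. m \<le> up n \<and> m l \<noteq> 0}. of_nat (mchoose n (m(l := m l - 1))) * A m)"
      by (rule sum.mono_neutral_cong_right) auto
    also have "\<dots> = (\<Sum>m\<in>{..n}. of_nat (mchoose n m) * A (up m))"
      by (rule sum.reindex_bij_witness[of _ up "\<lambda>m. m(l := m l - 1)"])
        (auto simp: up_def le_fun_def split: if_splits)
    also have "\<dots> = hcoeff (hderiv l f * g) n"
    proof -
      have diff: "up n - up m = n - m" for m
        by (auto simp: fun_eq_iff up_def)
      show ?thesis
        unfolding hcoeff_mult A_def diff
        by (simp add: hcoeff_hderiv up_def mult.assoc)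
    qed
    finally show ?thesis .
  qed
  finally show "hcoeff (hderiv l (f * g)) n = hcoeff (hderiv l f * g + f * hderiv l g) n"
    by (simp add: hcoeff_add add.commute)
qed

lemma DD_add_right: "DD \<phi> (F + G) = DD \<phi> F + DD \<phi> G"
  by (simp add: DD_def vec_eq_iff hderiv_add distrib_right sum.distrib)

lemma DD_add_left: "DD (\<phi> + \<psi>) F = DD \<phi> F + DD \<psi> F"
  by (simp add: DD_def vec_eq_iff distrib_left sum.distrib)

lemma DD_mult: "DD \<phi> (F * G) = DD \<phi> F * G + F * DD \<phi> G"
  by (simp add: DD_def vec_eq_iff hderiv_mult sum_distrib_left sum.distrib[symmetric]
      algebra_simps)

lemma DD_zero_left: "DD 0 F = 0"
  by (simp add: DD_def vec_eq_iff)

lemma DD_zero_right: "DD \<phi> 0 = 0"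
  using DD_add_right[of \<phi> 0 0] by simp

lemma DD_one_right: "DD \<phi> 1 = 0"
  using DD_mult[of \<phi> 1 1] by simp

lemma DD_sum: "DD \<phi> (\<Sum>i\<in>I. F i) = (\<Sum>i\<in>I. DD \<phi> (F i))"
  by (induction I rule: infinite_finite_induct) (simp_all add: DD_zero_right DD_add_right)

lemma DD_of_nat_mult: "DD \<phi> (of_nat c * F) = of_nat c * DD \<phi> F"
proof -
  have "DD \<phi> (of_nat c) = 0"
    by (induction c) (simp_all add: DD_zero_right DD_add_right DD_one_right)
  then show ?thesis by (simp add: DD_mult)
qed

text \<open>
  The general Leibniz rule, by induction from the product rule: \<^term>\<open>DD \<theta>\<close> is additive and kills
  the binomial coefficients, and Pascal's rule merges the two shifted sums.
\<close>

lemma funpow_DD_mult: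
  "(DD \<theta> ^^ n) (F * G) =
     (\<Sum>l=0..n. of_nat (n choose l) * ((DD \<theta> ^^ l) F * (DD \<theta> ^^ (n - l)) G))"
proof (induction n)
  case (Suc n)
  define a b where "a l = (DD \<theta> ^^ l) F" and "b l = (DD \<theta> ^^ l) G" for l
  have D: "DD \<theta> (a l) = a (Suc l)" "DD \<theta> (b l) = b (Suc l)" for l
    by (simp_all add: a_def b_def)
  have "(DD \<theta> ^^ Suc n) (F * G) = DD \<theta> (\<Sum>l=0..n. of_nat (n choose l) * (a l * b (n - l)))"
    by (simp add: Suc.IH a_def b_def)
  also have "\<dots> = (\<Sum>l=0..n. of_nat (n choose l) * (a (Suc l) * b (n - l))) +
      (\<Sum>l=0..n. of_nat (n choose l) * (a l * b (Suc n - l)))"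
    by (simp add: DD_sum DD_of_nat_mult DD_mult[of _ "a _"] D sum.distrib[symmetric]
        distrib_left Suc_diff_le)
  also have "(\<Sum>l=0..n. of_nat (n choose l) * (a l * b (Suc n - l))) =
      (\<Sum>l=0..Suc n. of_nat (n choose l) * (a l * b (Suc n - l)))"
    by (simp add: binomial_eq_0)
  also have "\<dots> = a 0 * b (Suc n) + (\<Sum>l=0..n. of_nat (n choose Suc l) * (a (Suc l) * b (n - l)))"
    by (simp add: sum.atLeast0_atMost_Suc_shift del: sum.cl_ivl_Suc)
  also have "(\<Sum>l=0..n. of_nat (n choose l) * (a (Suc l) * b (n - l))) +
      (a 0 * b (Suc n) + (\<Sum>l=0..n. of_nat (n choose Suc l) * (a (Suc l) * b (n - l)))) =
      (\<Sum>l=0..Suc n. of_nat (Suc n choose l) * (a l * b (Suc n - l)))"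
    by (simp add: sum.atLeast0_atMost_Suc_shift distrib_right sum.distrib add_ac
        del: sum.cl_ivl_Suc)
  finally show ?case by (simp only: a_def b_def)
qed simp

section \<open>The sum and product of sequences\<close>

text \<open>
  Applying \<^term>\<open>DD (\<phi> + \<psi>) = (\<lambda>F. DD \<phi> F + DD \<psi> F)\<close> to the pure powers of order \<open>n\<close> gives the
  pure powers of order \<open>n + 1\<close> and the two mixed terms in the recursion for \<^term>\<open>HH \<phi> \<psi>\<close>, whose
  last summand carries the earlier mixed terms along.
\<close>

lemma sum_seq_eq_AA: "sum_seq \<phi> \<psi> = AA (\<phi> + \<psi>) xvec"
proof -
  have step: "(DD (\<phi> + \<psi>) ^^ Suc n) xvec =
      (DD \<phi> ^^ Suc n) xvec + (DD \<psi> ^^ Suc n) xvec + HH \<phi> \<psi> (Suc n)" for n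
  proof (induction n)
    case 0
    show ?case by (simp add: DD_add_left)
  next
    case (Suc n)
    have "(DD (\<phi> + \<psi>) ^^ Suc (Suc n)) xvec = DD (\<phi> + \<psi>) ((DD (\<phi> + \<psi>) ^^ Suc n) xvec)"
      by simp
    also have "\<dots> = DD (\<phi> + \<psi>) ((DD \<phi> ^^ Suc n) xvec) + DD (\<phi> + \<psi>) ((DD \<psi> ^^ Suc n) xvec)
        + DD (\<phi> + \<psi>) (HH \<phi> \<psi> (Suc n))"
      by (simp only: Suc.IH DD_add_right)
    also have "\<dots> = (DD \<phi> ^^ Suc (Suc n)) xvec + (DD \<psi> ^^ Suc (Suc n)) xvec + HH \<phi> \<psi> (Suc (Suc n))"
      by (simp add: DD_add_left add_ac)
    finally show ?case .
  qed
  show ?thesis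
  proof
    fix n
    show "sum_seq \<phi> \<psi> n = AA (\<phi> + \<psi>) xvec n"
    proof (cases n)
      case 0
      then show ?thesis by (simp add: sum_seq_def AA_def)
    next
      case (Suc m)
      then show ?thesis using step[of m]
        by (cases m) (simp_all add: sum_seq_def AA_def)
    qed
  qed
qed

text \<open>
  The first application of \<^term>\<open>DD (\<phi> * \<psi>)\<close> to \<^term>\<open>xvec\<close> produces the product \<open>\<phi> * \<psi>\<close>, which is
  why the binomial coefficients in \<^term>\<open>prod_seq \<phi> \<psi> n\<close> have upper index \<open>n - 1\<close>.
\<close>

lemma prod_seq_eq_AA: "prod_seq \<phi> \<psi> = AA (\<phi> * \<psi>) xvec"
proof
  fix n
  show "prod_seq \<phi> \<psi> n = AA (\<phi> * \<psi>) xvec n"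
  proof (cases n)
    case 0
    then show ?thesis by (simp add: prod_seq_def AA_def)
  next
    case (Suc m)
    have "AA (\<phi> * \<psi>) xvec n = (DD (\<phi> * \<psi>) ^^ m) (\<phi> * \<psi>)"
      by (simp only: Suc AA_def funpow_Suc_right o_apply DD_xvec)
    also have "\<dots> = prod_seq \<phi> \<psi> n"
      by (simp add: Suc prod_seq_def DD_xvec funpow_DD_mult)
    finally show ?thesis by simp
  qed
qed

section \<open>The ring of series in \<open>t\<close>\<close>

lemma boxplus_rho_AA: "boxplus (rho (AA \<phi> xvec)) (rho (AA \<psi> xvec)) = rho (AA (\<phi> + \<psi>) xvec)"
  by (simp add: boxplus_rho seq_boxplus_AA sum_seq_eq_AA)

lemma odot_rho_AA: "odot (rho (AA \<phi> xvec)) (rho (AA \<psi> xvec)) = rho (AA (\<phi> * \<psi>) xvec)"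
  by (simp add: odot_rho seq_odot_AA prod_seq_eq_AA)

lemma hcoeff_rho: "hcoeff (rho c) n = c (n ())"
  by (simp add: rho_def)

lemma rho_AA_zero: "rho (AA 0 xvec) = hconst xvec"
proof (rule hseries_eqI)
  fix n :: "unit \<Rightarrow> nat"
  have "n = (\<lambda>_. 0) \<longleftrightarrow> n () = 0"
    by (auto simp: fun_eq_iff)
  then show "hcoeff (rho (AA 0 xvec)) n = hcoeff (hconst xvec) n"
    by (cases "n ()") (simp_all add: hcoeff_rho AA_def hconst_def DD_zero_left)
qed

lemma hconst_one: "hconst 1 = 1"
  by (simp add: hconst_def one_hseries_def)

lemma rho_AA_one: "rho (AA 1 xvec) = hconst xvec + hconst 1 * hvar ()"
proof (rule hseries_eqI)
  fix n :: "unit \<Rightarrow> nat"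
  have n: "n = (\<lambda>_. 0) \<longleftrightarrow> n () = 0" "n = (\<lambda>_. 0)(() := 1) \<longleftrightarrow> n () = 1"
    by (auto simp: fun_eq_iff)
  have "AA 1 xvec m = (if m = 0 then xvec else if m = 1 then 1 else (0 :: ('a, 'b) hvec))" for m
  proof (induction m)
    case (Suc m)
    have "AA 1 xvec (Suc m) = DD 1 (AA 1 xvec m :: ('a, 'b) hvec)"
      by (simp add: AA_def)
    with Suc.IH show ?case
      by (simp add: DD_xvec DD_one_right DD_zero_right)
  qed (simp add: AA_def)
  then show "hcoeff (rho (AA 1 xvec)) n =
      hcoeff (hconst xvec + hconst 1 * hvar () :: (('a, 'b) hvec, unit) hseries) n"
    unfolding hconst_one mult_1_left
    by (simp add: hcoeff_add hcoeff_rho hconst_def hvar_def n[unfolded One_nat_def])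
qed

theorem theorem12:
  shows "cring \<lparr>carrier = {rho (AA \<phi> xvec) | \<phi> :: ('a::{idom, ring_char_0}, 'k::finite) hvec. True},
                mult = odot, one = rho (AA 1 xvec), zero = rho (AA 0 xvec), add = boxplus\<rparr> \<and>
         rho (AA (0 :: ('a, 'k) hvec) xvec) = hconst xvec \<and>
         rho (AA (1 :: ('a, 'k) hvec) xvec) = hconst xvec + hconst 1 * hvar ()"
    (is "cring ?S \<and> _")
proof -
  have "cring ?S"
  proof (rule cringI)
    show "abelian_group ?S"
    proof (rule abelian_groupI)
      fix x assume "x \<in> carrier ?S"
      then obtain \<phi> :: "('a, 'k) hvec" where x: "x = rho (AA \<phi> xvec)"
        by auto
      have "boxplus (rho (AA (- \<phi>) xvec)) x = rho (AA 0 xvec)"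
        by (simp add: x boxplus_rho_AA)
      then show "\<exists>y\<in>carrier ?S. y \<oplus>\<^bsub>?S\<^esub> x = \<zero>\<^bsub>?S\<^esub>"
        by auto
    qed (auto simp: boxplus_rho_AA add_ac)
    show "comm_monoid ?S"
      by (rule comm_monoidI) (auto simp: odot_rho_AA mult_ac)
  qed (auto simp: boxplus_rho_AA odot_rho_AA distrib_right)
  then show ?thesis
    by (simp only: rho_AA_zero rho_AA_one)
qed

end
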